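(* The triple $(\mathcal P,\leq,r)$, where $\mathcal P$ is the set of infinite countable ordered polyhedra, is a topological Ramsey space. That is, with respect to the topology on $\mathcal P$ generated by the sets $[(a,S_a),(A,S_A)]$ with $(a,S_a)\in\mathcal{AP}$ and $(A,S_A)\in\mathcal P$: every subset of $\mathcal P$ with the Baire property is Ramsey, and every meager subset of $\mathcal P$ is Ramsey null.
   Context: For a set $x$, $x^{[<\infty]}$ denotes the set of finite subsets of $x$. Consider pairs $(x,S_x)$ with (i) $x\subseteq\mathbb N$; (ii) $S_x\subseteq x^{[<\infty]}$ hereditary, i.e. $u\subseteq v$ and $v\in S_x$ imply $u\in S_x$; (iii) $\bigcup S_x=x$. $\mathcal{AP}$ (resp. $\mathcal P$) is the set of all such pairs with $x$ finite (resp. infinite); for $x=\emptyset$ the only pair considered is $(\emptyset,\{\emptyset\})$, also denoted $\emptyset$. Define $(y,S_y)\leq(x,S_x)$ iff $y\subseteq x$ and $S_y\subseteq S_x$. For $(A,S_A)\in\mathcal P$ and $n\in\mathbb N$, let $A\upharpoonright_n$ be the set of the first $n$ elements of $A$, and $r_n(A,S_A)=(A\upharpoonright_n,\{u\cap A\upharpoonright_n : u\in S_A\})\in\mathcal{AP}$, the $n$-th approximation; $r$ is the map $((A,S_A),n)\mapsto r_n(A,S_A)$. For $(a,S_a)\in\mathcal{AP}$ and $(A,S_A)\in\mathcal P$, put $[(a,S_a),(A,S_A)]=\{(B,S_B)\in\mathcal P : (B,S_B)\leq(A,S_A)\text{ and }r_n(B,S_B)=(a,S_a)\text{ for some }n\}$.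 A set $\mathcal X\subseteq\mathcal P$ is Ramsey if for every nonempty $[(a,S_a),(A,S_A)]$ there is $(B,S_B)\in[(a,S_a),(A,S_A)]$ such that $[(a,S_a),(B,S_B)]\subseteq\mathcal X$ or $[(a,S_a),(B,S_B)]\cap\mathcal X=\emptyset$. It is Ramsey null if for every nonempty $[(a,S_a),(A,S_A)]$ there is $(B,S_B)\in[(a,S_a),(A,S_A)]$ such that $[(a,S_a),(B,S_B)]\cap\mathcal X=\emptyset$. *)

theory Defs
  imports "HOL-Analysis.Analysis"
begin

section \<open>Category notions in a topological space\<close>

definition nowhere_dense_in :: "'a topology \<Rightarrow> 'a set \<Rightarrow> bool" where
  "nowhere_dense_in T N \<longleftrightarrow> N \<subseteq> topspace T \<and> T interior_of (T closure_of N) = {}"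

definition meager_in :: "'a topology \<Rightarrow> 'a set \<Rightarrow> bool" where
  "meager_in T X \<longleftrightarrow> (\<exists>\<N>. countable \<N> \<and> (\<forall>N\<in>\<N>. nowhere_dense_in T N) \<and> X = \<Union>\<N>)"

definition Baire_property_in :: "'a topology \<Rightarrow> 'a set \<Rightarrow> bool" where
  "Baire_property_in T X \<longleftrightarrow>
     X \<subseteq> topspace T \<and> (\<exists>U. openin T U \<and> meager_in T (sym_diff X U))"

section \<open>Topological Ramsey spaces\<close>

text \<open>Throughout, \<open>R\<close> is the space, \<open>Ap\<close> the set of approximations,
  \<open>le\<close> the relation on \<open>R\<close>, and \<open>r A n\<close> the \<open>n\<close>-th approximation of \<open>A\<close>.\<close>

definition basic_set ::
    "'a set \<Rightarrow> ('a \<Rightarrow> 'a \<Rightarrow> bool) \<Rightarrow> ('a \<Rightarrow> nat \<Rightarrow> 'b) \<Rightarrow> 'b \<Rightarrow> 'a \<Rightarrow> 'a set" where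
  "basic_set R le r a A = {B \<in> R. le B A \<and> (\<exists>n. r B n = a)}"

definition Ramsey_topology ::
    "'a set \<Rightarrow> 'b set \<Rightarrow> ('a \<Rightarrow> 'a \<Rightarrow> bool) \<Rightarrow> ('a \<Rightarrow> nat \<Rightarrow> 'b) \<Rightarrow> 'a topology" where
  "Ramsey_topology R Ap le r =
     topology_generated_by {basic_set R le r a A | a A. a \<in> Ap \<and> A \<in> R}"

definition Ramsey_set ::
    "'a set \<Rightarrow> 'b set \<Rightarrow> ('a \<Rightarrow> 'a \<Rightarrow> bool) \<Rightarrow> ('a \<Rightarrow> nat \<Rightarrow> 'b) \<Rightarrow> 'a set \<Rightarrow> bool" where
  "Ramsey_set R Ap le r X \<longleftrightarrow>
     (\<forall>a\<in>Ap. \<forall>A\<in>R. basic_set R le r a A \<noteq> {} \<longrightarrow>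
        (\<exists>B\<in>basic_set R le r a A.
           basic_set R le r a B \<subseteq> X \<or> basic_set R le r a B \<inter> X = {}))"

definition Ramsey_null_set ::
    "'a set \<Rightarrow> 'b set \<Rightarrow> ('a \<Rightarrow> 'a \<Rightarrow> bool) \<Rightarrow> ('a \<Rightarrow> nat \<Rightarrow> 'b) \<Rightarrow> 'a set \<Rightarrow> bool" where
  "Ramsey_null_set R Ap le r X \<longleftrightarrow>
     (\<forall>a\<in>Ap. \<forall>A\<in>R. basic_set R le r a A \<noteq> {} \<longrightarrow>
        (\<exists>B\<in>basic_set R le r a A. basic_set R le r a B \<inter> X = {}))"

definition topological_Ramsey_space ::
    "'a set \<Rightarrow> 'b set \<Rightarrow> ('a \<Rightarrow> 'a \<Rightarrow> bool) \<Rightarrow> ('a \<Rightarrow> nat \<Rightarrow> 'b) \<Rightarrow> bool" where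
  "topological_Ramsey_space R Ap le r \<longleftrightarrow>
     (\<forall>X\<subseteq>R. Baire_property_in (Ramsey_topology R Ap le r) X \<longrightarrow> Ramsey_set R Ap le r X) \<and>
     (\<forall>X\<subseteq>R. meager_in (Ramsey_topology R Ap le r) X \<longrightarrow> Ramsey_null_set R Ap le r X)"

section \<open>Ordered polyhedra\<close>

type_synonym polyhedron = "nat set \<times> nat set set"

definition is_polyhedron :: "polyhedron \<Rightarrow> bool" where
  "is_polyhedron = (\<lambda>(x, S).
     S \<subseteq> Fpow x \<and> (\<forall>u v. u \<subseteq> v \<and> v \<in> S \<longrightarrow> u \<in> S) \<and> \<Union>S = x \<and>
     (x = {} \<longrightarrow> S = {{}}))"

definition finite_polyhedra :: "polyhedron set" where
  "finite_polyhedra = {P. is_polyhedron P \<and> finite (fst P)}"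

definition infinite_polyhedra :: "polyhedron set" where
  "infinite_polyhedra = {P. is_polyhedron P \<and> infinite (fst P)}"

definition polyhedron_le :: "polyhedron \<Rightarrow> polyhedron \<Rightarrow> bool" where
  "polyhedron_le = (\<lambda>(y, T) (x, S). y \<subseteq> x \<and> T \<subseteq> S)"

definition first_elements :: "nat set \<Rightarrow> nat \<Rightarrow> nat set" where
  "first_elements A n = enumerate A ` {..<n}"

text \<open>Only meaningful for polyhedra with infinitely many vertices, since \<open>enumerate\<close>
  is unspecified beyond the cardinality of a finite set.\<close>

definition approximation :: "polyhedron \<Rightarrow> nat \<Rightarrow> polyhedron" where
  "approximation = (\<lambda>(A, S) n.
     (first_elements A n, {u \<inter> first_elements A n | u. u \<in> S}))"

end

theory Submission
  imports Defs
begin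

text \<open>Simplices may be discarded when passing to a smaller polyhedron. Hence every nonempty
  \<open>[a, A]\<close> contains a polyhedron \<open>B\<close> consisting of \<open>a\<close> and infinitely many isolated
  vertices. Every element of \<open>[a, B]\<close> is again \<open>a\<close> together with infinitely many of these
  vertices, so \<open>[a, B]\<close> is a copy of the Ellentuck space of infinite subsets of \<open>\<nat>\<close>. As
  \<open>[a, B]\<close> is open, open, nowhere dense and meager sets restrict to such sets in the
  Ellentuck space, and Ellentuck's theorem applies.\<close>

section \<open>The Ellentuck theorem\<close>

text \<open>The Ellentuck basic set \<open>[s, A]\<close>, written by splitting off the part
  \<open>Y\<close> beyond the stem; \<open>s\<close> itself need not lie in
  \<open>A\<close>.\<close>

definition ellentuck_nbhd :: "nat set \<Rightarrow> nat set \<Rightarrow> nat set set" where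
  "ellentuck_nbhd s A = {s \<union> Y | Y. infinite Y \<and> Y \<subseteq> A \<and> (\<forall>i\<in>s. \<forall>j\<in>Y. i < j)}"

text \<open>The condition \<open>Y \<in> ellentuck_nbhd s Y\<close> makes \<open>s\<close> a finite
  initial segment of \<open>Y\<close>. Only infinite members are tested, so that \<open>W\<close>
  may be a preimage in the full power set of the naturals.\<close>

definition ellentuck_open :: "nat set set \<Rightarrow> bool" where
  "ellentuck_open W \<longleftrightarrow>
     (\<forall>Y\<in>W. infinite Y \<longrightarrow> (\<exists>s. finite s \<and> Y \<in> ellentuck_nbhd s Y \<and> ellentuck_nbhd s Y \<subseteq> W))"

definition completely_Ramsey :: "nat set set \<Rightarrow> bool" where
  "completely_Ramsey W \<longleftrightarrow> (\<forall>s A. finite s \<and> infinite A \<longrightarrow>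
     (\<exists>B\<subseteq>A. infinite B \<and> (ellentuck_nbhd s B \<subseteq> W \<or> ellentuck_nbhd s B \<inter> W = {})))"

definition completely_Ramsey_null :: "nat set set \<Rightarrow> bool" where
  "completely_Ramsey_null W \<longleftrightarrow> (\<forall>s A. finite s \<and> infinite A \<longrightarrow>
     (\<exists>B\<subseteq>A. infinite B \<and> ellentuck_nbhd s B \<inter> W = {}))"

lemma infinite_above:
  fixes A s :: "nat set"
  assumes "finite s" "infinite A"
  shows "infinite {x \<in> A. \<forall>i\<in>s. i < x}"
proof -
  obtain m where m: "\<forall>i\<in>s. i < m"
    using finite_nat_set_iff_bounded assms(1) by auto
  have "A - {..<m} \<subseteq> {x \<in> A. \<forall>i\<in>s. i < x}"
    using m by force
  moreover have "infinite (A - {..<m})"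
    using assms(2) by simp
  ultimately show ?thesis
    using infinite_super by blast
qed

lemma ellentuck_nbhdI:
  "X = s \<union> Y \<Longrightarrow> infinite Y \<Longrightarrow> Y \<subseteq> A \<Longrightarrow> \<forall>i\<in>s. \<forall>j\<in>Y. i < j \<Longrightarrow> X \<in> ellentuck_nbhd s A"
  unfolding ellentuck_nbhd_def by (intro CollectI exI[of _ Y] conjI)

lemma ellentuck_nbhdE:
  assumes "X \<in> ellentuck_nbhd s A"
  obtains Y where "X = s \<union> Y" "infinite Y" "Y \<subseteq> A" "\<forall>i\<in>s. \<forall>j\<in>Y. i < j"
  using assms unfolding ellentuck_nbhd_def by (elim CollectE exE conjE)

text \<open>Only the elements of \<open>C\<close> beyond the stem can occur in the added part. This
  supplies the hypothesis \<open>tail\<close> whenever \<open>fusion\<close> is applied to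
  neighbourhoods.\<close>

lemma ellentuck_nbhd_tail_mono:
  assumes "{x \<in> C. \<forall>i\<in>s. i < x} \<subseteq> B"
  shows "ellentuck_nbhd s C \<subseteq> ellentuck_nbhd s B"
proof
  fix X
  assume "X \<in> ellentuck_nbhd s C"
  then obtain Y where Y: "X = s \<union> Y" "infinite Y" "Y \<subseteq> C" "\<forall>i\<in>s. \<forall>j\<in>Y. i < j"
    by (rule ellentuck_nbhdE)
  then have "Y \<subseteq> B"
    using assms by blast
  then show "X \<in> ellentuck_nbhd s B"
    using Y by (intro ellentuck_nbhdI[of _ s Y])
qed

lemma ellentuck_nbhd_mono: "B \<subseteq> A \<Longrightarrow> ellentuck_nbhd s B \<subseteq> ellentuck_nbhd s A"
  by (rule ellentuck_nbhd_tail_mono) auto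

section \<open>Fusion of infinite sets of natural numbers\<close>

lemma finite_simultaneous:
  fixes P :: "'a set \<Rightarrow> nat set \<Rightarrow> bool"
  assumes "finite F"
    and dense: "\<And>s B. s \<in> F \<Longrightarrow> infinite B \<Longrightarrow> B \<subseteq> A \<Longrightarrow> \<exists>C\<subseteq>B. infinite C \<and> P s C"
    and mono: "\<And>s B C. P s B \<Longrightarrow> C \<subseteq> B \<Longrightarrow> P s C"
    and "infinite B" "B \<subseteq> A"
  shows "\<exists>C\<subseteq>B. infinite C \<and> (\<forall>s\<in>F. P s C)"
  using assms(1) dense
proof (induction F)
  case empty
  then show ?case using assms(4) by auto
next
  case (insert s F)
  then obtain C where C: "C \<subseteq> B" "infinite C" "\<forall>s\<in>F. P s C"
    by (metis insertCI)
  then obtain D where "D \<subseteq> C" "infinite D" "P s D"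
    using insert.prems[of s C] assms(5) by auto
  then show ?case
    using C mono by (intro exI[of _ D]) auto
qed

text \<open>Diagonal argument: build a decreasing sequence \<open>D\<close> where \<open>D k\<close>
  settles the finitely many stems inside \<open>A \<inter> {..<k}\<close>, then pick
  \<open>b j\<close> so that everything after \<open>b j\<close> comes from
  \<open>D (Suc (b j))\<close>. By \<open>tail\<close>, what \<open>D (Suc (b j))\<close> settles
  for stems with maximum \<open>b j\<close> passes to \<open>range b\<close>.\<close>

lemma fusion:
  fixes P :: "nat set \<Rightarrow> nat set \<Rightarrow> bool"
  assumes "infinite A"
    and dense: "\<And>s B. finite s \<Longrightarrow> s \<subseteq> A \<Longrightarrow> infinite B \<Longrightarrow> B \<subseteq> A \<Longrightarrow>
      \<exists>C\<subseteq>B. infinite C \<and> P s C"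
    and tail: "\<And>s B C. P s B \<Longrightarrow> {x \<in> C. \<forall>i\<in>s. i < x} \<subseteq> B \<Longrightarrow> P s C"
  shows "\<exists>B\<subseteq>A. infinite B \<and> (\<forall>s. finite s \<and> s \<subseteq> B \<longrightarrow> P s B)"
proof -
  define Q where "Q = (\<lambda>k D. infinite D \<and> D \<subseteq> A \<and> (\<forall>s\<in>Pow (A \<inter> {..<k}). P s D))"
  have step: "\<exists>C. Q k C \<and> C \<subseteq> B" if "infinite B" "B \<subseteq> A" for k :: nat and B
  proof -
    have "\<exists>C\<subseteq>B. infinite C \<and> (\<forall>s\<in>Pow (A \<inter> {..<k}). P s C)"
    proof (rule finite_simultaneous[OF _ _ _ that])
      show "\<exists>C\<subseteq>B. infinite C \<and> P s C"
        if "s \<in> Pow (A \<inter> {..<k})" "infinite B" "B \<subseteq> A" for s B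
        using dense[of s B] that finite_subset[of s "A \<inter> {..<k}"] by auto
      show "P s C" if "P s B" "C \<subseteq> B" for s B C
        using tail[of s B C] that by auto
    qed simp
    then show ?thesis
      using that unfolding Q_def by blast
  qed
  have "\<exists>D. \<forall>k. Q k (D k) \<and> D (Suc k) \<subseteq> D k"
  proof (rule dependent_nat_choice)
    show "\<exists>D. Q 0 D"
      using step[OF assms(1)] by blast
    show "\<exists>C. Q (Suc k) C \<and> C \<subseteq> D" if "Q k D" for D k
      using step[of D "Suc k"] that unfolding Q_def by blast
  qed
  then obtain D where D: "\<And>k. Q k (D k)" and D_Suc: "\<And>k. D (Suc k) \<subseteq> D k"
    by blast
  have D_mono: "D j \<subseteq> D i" if "i \<le> j" for i j
    using lift_Suc_antimono_le[of D, OF D_Suc that] .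
  \<comment> \<open>The index \<open>Suc (b j)\<close> is what lets stems containing
    \<open>b j\<close> itself be covered by \<open>Q\<close>.\<close>
  have "\<exists>b. \<forall>j::nat. (j = 0 \<longrightarrow> b j \<in> D 0) \<and> (b (Suc j) > b j \<and> b (Suc j) \<in> D (Suc (b j)))"
  proof (rule dependent_nat_choice)
    have "D 0 \<noteq> {}"
      using D[of 0] unfolding Q_def by auto
    then show "\<exists>x. (0::nat) = 0 \<longrightarrow> x \<in> D 0"
      by auto
    show "\<exists>y. (Suc j = 0 \<longrightarrow> y \<in> D 0) \<and> y > x \<and> y \<in> D (Suc x)" for x j
    proof -
      have "infinite (D (Suc x))"
        using D[of "Suc x"] unfolding Q_def by auto
      then show ?thesis
        by (metis infinite_nat_iff_unbounded nat.distinct(1))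
    qed
  qed
  then obtain b where b0: "b 0 \<in> D 0" and b: "\<And>j. b (Suc j) > b j" "\<And>j. b (Suc j) \<in> D (Suc (b j))"
    by blast
  have b_mono: "strict_mono b"
    using b(1) by (simp add: strict_mono_Suc_iff)
  have b_D0: "b j \<in> D 0" for j
    using b0 b(2) D_mono[of 0] by (cases j) auto
  have D0_A: "D 0 \<subseteq> A"
    using D[of 0] unfolding Q_def by auto
  have "P s (range b)" if s: "finite s" "s \<subseteq> range b" for s
  proof (cases "s = {}")
    \<comment> \<open>The empty stem has no maximum; here \<open>D 0\<close> serves, as it contains
      all of \<open>range b\<close>.\<close>
    case True
    have "P {} (D 0)"
      using D[of 0] unfolding Q_def by auto
    then show ?thesis
      using tail[of "{}" "D 0" "range b"] True b_D0 by auto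
  next
    case False
    then obtain j where j: "Max s = b j"
      using s Max_in by blast
    have below: "i \<le> b j" if "i \<in> s" for i
      using j s(1) that by (metis Max_ge)
    have "s \<in> Pow (A \<inter> {..<Suc (b j)})"
      using s(2) below b_D0 D0_A by (auto simp: less_Suc_eq_le)
    then have "P s (D (Suc (b j)))"
      using D[of "Suc (b j)"] unfolding Q_def by blast
    moreover have "x \<in> D (Suc (b j))" if x: "x \<in> range b" "\<forall>i\<in>s. i < x" for x
    proof -
      obtain l where l: "x = b l"
        using x(1) by blast
      have "b j < b l"
        using x l j Max_in[OF s(1) False] by auto
      then have "j < l"
        using b_mono by (simp add: strict_mono_less)
      then obtain l' where l': "l = Suc l'" "j \<le> l'"
        by (metis less_Suc_eq_le less_imp_Suc_add)
      then have "b j \<le> b l'"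
        using b_mono by (simp add: strict_mono_less_eq)
      then show ?thesis
        using l l' b(2)[of l'] D_mono[of "Suc (b j)" "Suc (b l')"] by auto
    qed
    then have "{x \<in> range b. \<forall>i\<in>s. i < x} \<subseteq> D (Suc (b j))"
      by blast
    ultimately show ?thesis
      by (rule tail)
  qed
  moreover have "infinite (range b)"
    using b_mono by (simp add: range_inj_infinite strict_mono_imp_inj_on)
  moreover have "range b \<subseteq> A"
    using b_D0 D0_A by auto
  ultimately show ?thesis
    by blast
qed

section \<open>Open sets are completely Ramsey\<close>

lemma ellentuck_nbhd_insertI:
  assumes "Y \<in> ellentuck_nbhd s A"
  obtains n where "n \<in> A" "\<forall>i\<in>s. i < n" "Y \<in> ellentuck_nbhd (insert n s) A"
proof -
  obtain Z where Z: "Y = s \<union> Z" "infinite Z" "Z \<subseteq> A" "\<forall>i\<in>s. \<forall>j\<in>Z. i < j"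
    using assms by (rule ellentuck_nbhdE)
  define n where "n = (LEAST n. n \<in> Z)"
  have n: "n \<in> Z" "\<forall>z\<in>Z. n \<le> z"
    using Z(2) unfolding n_def
    by (auto intro: LeastI_ex Least_le simp: ex_in_conv)
  have "\<forall>z\<in>Z - {n}. n < z"
    using n(2) by (simp add: le_neq_implies_less)
  then have "Y \<in> ellentuck_nbhd (insert n s) A"
    using n Z by (intro ellentuck_nbhdI[of _ _ "Z - {n}"]) auto
  then show ?thesis
    using that n Z by blast
qed

text \<open>Galvin--Prikry combinatorial forcing: \<open>B\<close> accepts \<open>t\<close> if \<open>ellentuck_nbhd (s \<union> t) B \<subseteq> W\<close>.
  A first fusion yields \<open>M\<close> deciding all its finite subsets; if \<open>M\<close> does not accept
  \<open>{}\<close>, a second fusion yields \<open>H \<subseteq> M\<close> all of whose finite subsets are rejected.\<close>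

lemma ellentuck_open_imp_completely_Ramsey:
  assumes W: "ellentuck_open W"
  shows "completely_Ramsey W"
  unfolding completely_Ramsey_def
proof (intro allI impI, elim conjE)
  fix s A :: "nat set"
  assume s: "finite s" and A: "infinite A"
  define A' where "A' = {x \<in> A. \<forall>i\<in>s. i < x}"
  have A': "infinite A'"
    using infinite_above[OF s A] unfolding A'_def .
  define acc where "acc = (\<lambda>t B. ellentuck_nbhd (s \<union> t) B \<subseteq> W)"
  have acc_tail: "acc t C" if "acc t B" "{x \<in> C. \<forall>i\<in>t. i < x} \<subseteq> B" for t B C
  proof -
    have "ellentuck_nbhd (s \<union> t) C \<subseteq> ellentuck_nbhd (s \<union> t) B"
      using that(2) by (intro ellentuck_nbhd_tail_mono) blast
    then show ?thesis
      using that(1) unfolding acc_def by blast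
  qed
  define dec where "dec = (\<lambda>t B. acc t B \<or> (\<forall>C\<subseteq>B. infinite C \<longrightarrow> \<not> acc t C))"
  \<comment> \<open>Finiteness of \<open>t\<close> is carried inside the predicate because the
    hypothesis \<open>tail\<close> of \<open>fusion\<close> does not supply it, while
    \<open>infinite_above\<close> needs it.\<close>
  have "\<exists>M\<subseteq>A'. infinite M \<and> (\<forall>t. finite t \<and> t \<subseteq> M \<longrightarrow> dec t M \<and> finite t)"
  proof (rule fusion[OF A'])
    show "\<exists>C\<subseteq>B. infinite C \<and> dec t C \<and> finite t" if "finite t" "infinite B" for t B
      using that unfolding dec_def by blast
    show "dec t C \<and> finite t"
      if t: "dec t B \<and> finite t" and sub: "{x \<in> C. \<forall>i\<in>t. i < x} \<subseteq> B" for t B C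
    proof -
      \<comment> \<open>If some infinite \<open>D \<subseteq> C\<close> accepts \<open>t\<close>, so
        does its part beyond \<open>t\<close>, which lies in \<open>B\<close>. Hence
        \<open>B\<close> does not reject \<open>t\<close>, and being decided it accepts.\<close>
      have "acc t B" if "D \<subseteq> C" "infinite D" "acc t D" for D
      proof -
        define D' where "D' = {x \<in> D. \<forall>i\<in>t. i < x}"
        have "acc t D'"
          using acc_tail[OF that(3), of D'] unfolding D'_def by blast
        moreover have "infinite D'"
          unfolding D'_def using t that by (intro infinite_above) auto
        moreover have "D' \<subseteq> B"
          using sub that(1) unfolding D'_def by blast
        ultimately show ?thesis
          using t unfolding dec_def by blast
      qed
      then show ?thesis
        using t acc_tail[OF _ sub] unfolding dec_def by blast
    qed
  qed
  then obtain M where M: "M \<subseteq> A'" "infinite M"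
    and M_dec: "\<forall>t. finite t \<and> t \<subseteq> M \<longrightarrow> dec t M \<and> finite t"
    by (elim exE conjE) (rule that)
  have dec: "dec t M" if "finite t" "t \<subseteq> M" for t
    using M_dec that by simp
  show "\<exists>B\<subseteq>A. infinite B \<and> (ellentuck_nbhd s B \<subseteq> W \<or> ellentuck_nbhd s B \<inter> W = {})"
  proof (cases "acc {} M")
    case True
    then show ?thesis
      using M unfolding acc_def A'_def by (intro exI[of _ M]) auto
  next
    case False
    have "\<exists>H\<subseteq>M. infinite H \<and> (\<forall>t. finite t \<and> t \<subseteq> H \<longrightarrow>
      (\<not> acc t M \<longrightarrow> (\<forall>n\<in>H. (\<forall>i\<in>t. i < n) \<longrightarrow> \<not> acc (insert n t) M)))"
    proof (rule fusion[OF M(2)])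
      fix t B
      assume t: "finite t" "t \<subseteq> M" and B: "infinite B" "B \<subseteq> M"
      define G where "G = {n \<in> B. (\<forall>i\<in>t. i < n) \<and> acc (insert n t) M}"
      \<comment> \<open>Otherwise \<open>G\<close> accepts \<open>t\<close>: a member of a
        neighbourhood with stem \<open>s \<union> t\<close> in \<open>G\<close> has a first new
        element \<open>n\<close>, and \<open>M\<close> accepts \<open>insert n t\<close>. Since
        \<open>M\<close> decides \<open>t\<close>, it would accept \<open>t\<close> too.\<close>
      have "finite G" if "\<not> acc t M"
      proof (rule ccontr)
        assume "infinite G"
        have "acc t G"
          unfolding acc_def
        proof
          fix Y
          assume "Y \<in> ellentuck_nbhd (s \<union> t) G"
          then obtain n where n: "n \<in> G" "Y \<in> ellentuck_nbhd (insert n (s \<union> t)) G"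
            by (rule ellentuck_nbhd_insertI)
          then have "Y \<in> ellentuck_nbhd (s \<union> insert n t) M"
            using ellentuck_nbhd_mono[of G M] B(2) unfolding G_def by auto
          then show "Y \<in> W"
            using n(1) unfolding G_def acc_def by blast
        qed
        moreover have "G \<subseteq> M"
          using B(2) unfolding G_def by blast
        ultimately show False
          using dec[OF t] that \<open>infinite G\<close> unfolding dec_def by simp
      qed
      then show "\<exists>C\<subseteq>B. infinite C \<and>
          (\<not> acc t M \<longrightarrow> (\<forall>n\<in>C. (\<forall>i\<in>t. i < n) \<longrightarrow> \<not> acc (insert n t) M))"
        using B(1) by (cases "acc t M") (blast, intro exI[of _ "B - G"], auto simp: G_def)
    qed auto
    then obtain H where H: "H \<subseteq> M" "infinite H" and step: "\<forall>t. finite t \<and> t \<subseteq> H \<longrightarrow>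
        (\<not> acc t M \<longrightarrow> (\<forall>n\<in>H. (\<forall>i\<in>t. i < n) \<longrightarrow> \<not> acc (insert n t) M))"
      by (elim exE conjE) (rule that)
    \<comment> \<open>Rejection spreads from the empty set by adding elements in increasing order,
      which is why the induction removes the maximum.\<close>
    have not_acc: "\<not> acc t M" if "finite t" "t \<subseteq> H" for t
      using that
    proof (induction t rule: finite_linorder_max_induct)
      case empty
      then show ?case using False by simp
    next
      case (insert n t)
      then show ?case using step by simp
    qed
    \<comment> \<open>Openness enters here: a neighbourhood of \<open>Y\<close> inside
      \<open>W\<close> would make the infinite set \<open>Z \<subseteq> M\<close> accept a finite
      subset of \<open>H\<close>, which \<open>M\<close> rejects.\<close>
    have "Y \<notin> W" if Y: "Y \<in> ellentuck_nbhd s H" for Y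
    proof
      assume "Y \<in> W"
      obtain Z where Z: "Y = s \<union> Z" "infinite Z" "Z \<subseteq> H" "\<forall>i\<in>s. \<forall>j\<in>Z. i < j"
        using Y by (rule ellentuck_nbhdE)
      then obtain u where u: "finite u" "Y \<in> ellentuck_nbhd u Y" "ellentuck_nbhd u Y \<subseteq> W"
        using \<open>Y \<in> W\<close> W unfolding ellentuck_open_def by (metis finite_Un)
      obtain Y' where Y': "Y = u \<union> Y'" "\<forall>i\<in>u. \<forall>j\<in>Y'. i < j"
        using u(2) by (rule ellentuck_nbhdE)
      define t where "t = u - s"
      have t: "finite t" "t \<subseteq> Z"
        using u(1) Y'(1) Z(1) unfolding t_def by auto
      have "ellentuck_nbhd (s \<union> t) Z \<subseteq> ellentuck_nbhd u Y"
      proof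
        fix X
        assume "X \<in> ellentuck_nbhd (s \<union> t) Z"
        then obtain V where V: "X = s \<union> t \<union> V" "infinite V" "V \<subseteq> Z" "\<forall>i\<in>s \<union> t. \<forall>j\<in>V. i < j"
          by (rule ellentuck_nbhdE)
        \<comment> \<open>The stem \<open>u\<close> may end before \<open>s\<close> does; the
          remaining part \<open>s - u\<close> is then counted among the elements beyond
          \<open>u\<close>.\<close>
        have "X = u \<union> ((s - u) \<union> V)"
          using V(1) unfolding t_def by blast
        moreover have "infinite ((s - u) \<union> V)"
          using V(2) by simp
        moreover have "(s - u) \<union> V \<subseteq> Y"
          using V(3) Z(1) by blast
        moreover have "i < j" if "i \<in> u" "j \<in> (s - u) \<union> V" for i j
        proof (cases "j \<in> V")
          case True
          then show ?thesis
            using V(4) that(1) unfolding t_def by blast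
        next
          case False
          then show ?thesis
            using that Y' Z(1) by blast
        qed
        ultimately show "X \<in> ellentuck_nbhd u Y"
          by (intro ellentuck_nbhdI[of _ _ "(s - u) \<union> V"]) auto
      qed
      then have "acc t Z"
        using u(3) unfolding acc_def by blast
      moreover have "dec t M" "\<not> acc t M"
        using dec[of t] not_acc[of t] t Z(3) H(1) by simp_all
      moreover have "Z \<subseteq> M"
        using Z(3) H(1) by simp
      ultimately show False
        using Z(2) unfolding dec_def by simp
    qed
    then show ?thesis
      using H M(1) unfolding A'_def by (intro exI[of _ H]) blast
  qed
qed

section \<open>Null sets, countable unions and the Baire property\<close>

lemma completely_Ramsey_null_disjoint_dense_open:
  assumes "ellentuck_open U"
    and dense: "\<And>s A. finite s \<Longrightarrow> infinite A \<Longrightarrow> ellentuck_nbhd s A \<inter> U \<noteq> {}"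
    and "N \<inter> U = {}"
  shows "completely_Ramsey_null N"
  unfolding completely_Ramsey_null_def
proof (intro allI impI, elim conjE)
  fix s A :: "nat set"
  assume s: "finite s" and A: "infinite A"
  obtain B where B: "B \<subseteq> A" "infinite B" "ellentuck_nbhd s B \<subseteq> U \<or> ellentuck_nbhd s B \<inter> U = {}"
    using ellentuck_open_imp_completely_Ramsey[OF assms(1)] s A
    unfolding completely_Ramsey_def by meson
  \<comment> \<open>Density rules out the disjoint alternative.\<close>
  then have "ellentuck_nbhd s B \<subseteq> U"
    using dense[OF s B(2)] by simp
  then show "\<exists>B\<subseteq>A. infinite B \<and> ellentuck_nbhd s B \<inter> N = {}"
    using B(1,2) assms(3) by (intro exI[of _ B]) auto
qed

lemma first_elements_eq:
  assumes "infinite A"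
  shows "first_elements A n = A \<inter> {..<enumerate A n}"
proof
  show "first_elements A n \<subseteq> A \<inter> {..<enumerate A n}"
    using assms unfolding first_elements_def by (auto simp: enumerate_in_set enumerate_mono)
  show "A \<inter> {..<enumerate A n} \<subseteq> first_elements A n"
  proof
    fix x
    assume x: "x \<in> A \<inter> {..<enumerate A n}"
    then obtain j where j: "enumerate A j = x"
      using enumerate_Ex[OF assms] by blast
    then have "j < n"
      using x enumerate_mono_iff[OF assms] by auto
    then show "x \<in> first_elements A n"
      using j unfolding first_elements_def by auto
  qed
qed

text \<open>One fusion treats all \<open>N i\<close> at once: the stem \<open>s \<union> t\<close>
  is made to avoid \<open>N (card t)\<close>. To see that \<open>Y\<close> avoids
  \<open>N i\<close>, take as \<open>t\<close> the first \<open>i\<close> elements of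
  \<open>Y\<close> beyond \<open>s\<close>.\<close>

lemma completely_Ramsey_null_UN:
  fixes N :: "nat \<Rightarrow> nat set set"
  assumes "\<And>i. completely_Ramsey_null (N i)"
  shows "completely_Ramsey_null (\<Union>i. N i)"
  unfolding completely_Ramsey_null_def
proof (intro allI impI, elim conjE)
  fix s A :: "nat set"
  assume s: "finite s" and A: "infinite A"
  have "\<exists>B\<subseteq>A. infinite B \<and>
    (\<forall>t. finite t \<and> t \<subseteq> B \<longrightarrow> ellentuck_nbhd (s \<union> t) B \<inter> N (card t) = {})"
  proof (rule fusion[OF A])
    show "\<exists>C\<subseteq>B. infinite C \<and> ellentuck_nbhd (s \<union> t) C \<inter> N (card t) = {}"
      if "finite t" "infinite B" for t B
      using assms[of "card t"] s that unfolding completely_Ramsey_null_def by auto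
    show "ellentuck_nbhd (s \<union> t) C \<inter> N (card t) = {}"
      if "ellentuck_nbhd (s \<union> t) B \<inter> N (card t) = {}" "{x \<in> C. \<forall>i\<in>t. i < x} \<subseteq> B" for t B C
      using that ellentuck_nbhd_tail_mono[of C "s \<union> t" B] by blast
  qed
  then obtain B where B: "B \<subseteq> A" "infinite B"
    "\<forall>t. finite t \<and> t \<subseteq> B \<longrightarrow> ellentuck_nbhd (s \<union> t) B \<inter> N (card t) = {}"
    by (elim exE conjE) (rule that)
  have "Y \<notin> N i" if Y: "Y \<in> ellentuck_nbhd s B" for Y i
  proof -
    obtain Z where Z: "Y = s \<union> Z" "infinite Z" "Z \<subseteq> B" "\<forall>i\<in>s. \<forall>j\<in>Z. i < j"
      using Y by (rule ellentuck_nbhdE)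
    define t where "t = first_elements Z i"
    have t_eq: "t = Z \<inter> {..<enumerate Z i}"
      unfolding t_def using Z(2) by (rule first_elements_eq)
    have "inj_on (enumerate Z) {..<i}"
      using inj_enumerate[OF Z(2)] by (rule inj_on_subset) simp
    then have "card t = i" "finite t"
      unfolding t_def first_elements_def by (simp_all add: card_image)
    moreover have "infinite (Z - t)"
      using Z(2) \<open>finite t\<close> by simp
    moreover have "\<forall>i\<in>s \<union> t. \<forall>j\<in>Z - t. i < j"
      using Z(4) unfolding t_eq by force
    moreover have "Y = (s \<union> t) \<union> (Z - t)" "t \<subseteq> B" "Z - t \<subseteq> B"
      using Z(1,3) t_eq by auto
    ultimately have "Y \<in> ellentuck_nbhd (s \<union> t) B"
      by (intro ellentuck_nbhdI[of _ _ "Z - t"])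
    then show ?thesis
      using B(3) \<open>finite t\<close> \<open>t \<subseteq> B\<close> \<open>card t = i\<close> by auto
  qed
  then show "\<exists>B\<subseteq>A. infinite B \<and> ellentuck_nbhd s B \<inter> (\<Union>i. N i) = {}"
    using B by (intro exI[of _ B]) auto
qed

lemma completely_Ramsey_null_Union:
  assumes "countable F" "\<And>N. N \<in> F \<Longrightarrow> completely_Ramsey_null N"
  shows "completely_Ramsey_null (\<Union>F)"
proof (cases "F = {}")
  case True
  then show ?thesis
    unfolding completely_Ramsey_null_def by auto
next
  case False
  have "completely_Ramsey_null (\<Union>i. from_nat_into F i)"
    using assms(2) from_nat_into[OF False] by (intro completely_Ramsey_null_UN) auto
  then show ?thesis
    using range_from_nat_into[OF False assms(1)] by simp
qed

text \<open>First shrink to avoid the symmetric difference, so that \<open>X\<close> and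
  \<open>U\<close> agree on the neighbourhood, then shrink again to decide the open set
  \<open>U\<close>.\<close>

lemma ellentuck_Baire_imp_completely_Ramsey:
  assumes "ellentuck_open U" "completely_Ramsey_null (sym_diff X U)"
  shows "completely_Ramsey X"
  unfolding completely_Ramsey_def
proof (intro allI impI, elim conjE)
  fix s A :: "nat set"
  assume s: "finite s" and A: "infinite A"
  obtain B where B: "B \<subseteq> A" "infinite B" "ellentuck_nbhd s B \<inter> sym_diff X U = {}"
    using assms(2) s A unfolding completely_Ramsey_null_def by meson
  obtain C where C: "C \<subseteq> B" "infinite C" "ellentuck_nbhd s C \<subseteq> U \<or> ellentuck_nbhd s C \<inter> U = {}"
    using ellentuck_open_imp_completely_Ramsey[OF assms(1)] s B(2)
    unfolding completely_Ramsey_def by meson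
  have "ellentuck_nbhd s C \<inter> sym_diff X U = {}"
    using B(3) ellentuck_nbhd_mono[OF C(1)] by blast
  then show "\<exists>B\<subseteq>A. infinite B \<and> (ellentuck_nbhd s B \<subseteq> X \<or> ellentuck_nbhd s B \<inter> X = {})"
    using B(1) C by (intro exI[of _ C]) blast
qed

section \<open>Polyhedra with isolated vertices added\<close>

text \<open>An approximation taken by a bound on the vertices instead of their number. The bound can
  be shared by different polyhedra, and the definition makes sense for finite ones.\<close>

definition cut :: "polyhedron \<Rightarrow> nat \<Rightarrow> polyhedron" where
  "cut P m = (fst P \<inter> {..<m}, (\<lambda>u. u \<inter> {..<m}) ` snd P)"

definition attach :: "polyhedron \<Rightarrow> nat set \<Rightarrow> polyhedron" where
  "attach a Y = (fst a \<union> Y, snd a \<union> (\<lambda>y. {y}) ` Y)"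

abbreviation pbasic :: "polyhedron \<Rightarrow> polyhedron \<Rightarrow> polyhedron set" where
  "pbasic \<equiv> basic_set infinite_polyhedra polyhedron_le approximation"

abbreviation ptopology :: "polyhedron topology" where
  "ptopology \<equiv>
     Ramsey_topology infinite_polyhedra finite_polyhedra polyhedron_le approximation"

lemma is_polyhedronD:
  assumes "is_polyhedron P"
  shows "\<And>u. u \<in> snd P \<Longrightarrow> u \<subseteq> fst P" "\<And>u. u \<in> snd P \<Longrightarrow> finite u"
    "\<And>u v. v \<in> snd P \<Longrightarrow> u \<subseteq> v \<Longrightarrow> u \<in> snd P" "\<Union>(snd P) = fst P"
    "{} \<in> snd P" "\<And>x. x \<in> fst P \<Longrightarrow> {x} \<in> snd P"
proof -
  obtain x S where P: "P = (x, S)"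
    by (cases P)
  note p = assms[unfolded is_polyhedron_def P split]
  show 1: "\<And>u. u \<in> snd P \<Longrightarrow> u \<subseteq> fst P" "\<And>u. u \<in> snd P \<Longrightarrow> finite u"
    using p unfolding P by (auto simp: Fpow_def)
  show 2: "\<And>u v. v \<in> snd P \<Longrightarrow> u \<subseteq> v \<Longrightarrow> u \<in> snd P" and 3: "\<Union>(snd P) = fst P"
    using p unfolding P by auto
  show "\<And>x. x \<in> fst P \<Longrightarrow> {x} \<in> snd P"
    using 2 3 by blast
  have "snd P \<noteq> {}"
    using p unfolding P by auto
  then show "{} \<in> snd P"
    using 2 by blast
qed

lemma polyhedron_le_iff: "polyhedron_le P Q \<longleftrightarrow> fst P \<subseteq> fst Q \<and> snd P \<subseteq> snd Q"
  unfolding polyhedron_le_def by (simp add: split_beta)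

lemma polyhedron_le_trans: "polyhedron_le P Q \<Longrightarrow> polyhedron_le Q R \<Longrightarrow> polyhedron_le P R"
  unfolding polyhedron_le_iff by blast

lemma is_polyhedron_attach:
  assumes "is_polyhedron a"
  shows "is_polyhedron (attach a Y)"
proof -
  note a = is_polyhedronD[OF assms]
  have "snd a = {{}}" if "fst a = {}"
    using a(1,5) that by blast
  then show ?thesis
    unfolding is_polyhedron_def attach_def split Fpow_def
    using a(1,2,4,5) by (auto simp: subset_singleton_iff intro: a(3))
qed

lemma attach_in_infinite_polyhedra:
  "a \<in> finite_polyhedra \<Longrightarrow> infinite Y \<Longrightarrow> attach a Y \<in> infinite_polyhedra"
  using is_polyhedron_attach[of a Y]
  by (simp add: finite_polyhedra_def infinite_polyhedra_def attach_def)

lemma attach_in_finite_polyhedra: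
  "a \<in> finite_polyhedra \<Longrightarrow> finite Y \<Longrightarrow> attach a Y \<in> finite_polyhedra"
  using is_polyhedron_attach[of a Y]
  by (simp add: finite_polyhedra_def attach_def)

lemma attach_attach: "attach (attach a Y) Z = attach a (Y \<union> Z)"
  unfolding attach_def by auto

text \<open>Approximations are the cuts at vertices, and cutting at any \<open>m\<close> equals
  cutting at the least vertex not below \<open>m\<close>, since no vertex lies in between.\<close>

lemma ex_approximation_iff:
  assumes "B \<in> infinite_polyhedra"
  shows "(\<exists>n. approximation B n = a) \<longleftrightarrow> (\<exists>m. cut B m = a)"
proof -
  have B: "is_polyhedron B" "infinite (fst B)"
    using assms unfolding infinite_polyhedra_def by auto
  have approx: "approximation B n = cut B (enumerate (fst B) n)" for n
  proof -
    have "u \<inter> first_elements (fst B) n = u \<inter> {..<enumerate (fst B) n}" if "u \<in> snd B" for u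
      using is_polyhedronD(1)[OF B(1) that] first_elements_eq[OF B(2)] by blast
    then show ?thesis
      unfolding approximation_def cut_def split_beta Setcompr_eq_image
      using first_elements_eq[OF B(2), of n] by (intro prod_eqI) (simp_all cong: image_cong)
  qed
  have "\<exists>n. cut B m = cut B (enumerate (fst B) n)" for m
  proof -
    define x where "x = (LEAST x. x \<in> fst B \<and> m \<le> x)"
    have "\<exists>x. x \<in> fst B \<and> m \<le> x"
      using B(2) by (meson infinite_nat_iff_unbounded_le)
    then have x: "x \<in> fst B" "m \<le> x" and least: "\<And>y. y \<in> fst B \<Longrightarrow> m \<le> y \<Longrightarrow> x \<le> y"
      unfolding x_def by (metis (mono_tags, lifting) LeastI_ex Least_le)+
    have eq: "v \<inter> {..<m} = v \<inter> {..<x}" if "v \<subseteq> fst B" for v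
      using that x(2) least by force
    have "cut B m = cut B x"
      unfolding cut_def using eq is_polyhedronD(1)[OF B(1)] by (intro prod_eqI) (simp_all cong: image_cong)
    moreover obtain n where "enumerate (fst B) n = x"
      using enumerate_Ex[OF B(2)] x(1) by blast
    ultimately show ?thesis
      by blast
  qed
  then show ?thesis
    unfolding approx by metis
qed

lemma in_pbasic_iff:
  "B \<in> pbasic a A \<longleftrightarrow> B \<in> infinite_polyhedra \<and> polyhedron_le B A \<and> (\<exists>m. cut B m = a)"
  unfolding basic_set_def using ex_approximation_iff by blast

lemma pbasicE:
  assumes "B \<in> pbasic a A"
  obtains m where "is_polyhedron B" "infinite (fst B)" "polyhedron_le B A" "cut B m = a"
proof -
  have "B \<in> infinite_polyhedra" "polyhedron_le B A" "\<exists>m. cut B m = a"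
    using assms unfolding in_pbasic_iff by simp_all
  then show thesis
    using that by (auto simp: infinite_polyhedra_def)
qed

lemma pbasic_mono: "polyhedron_le B A \<Longrightarrow> pbasic a B \<subseteq> pbasic a A"
  unfolding basic_set_def using polyhedron_le_trans by blast

lemma cut_attach:
  assumes a: "is_polyhedron a" and "fst a \<subseteq> {..<m}" "Y \<subseteq> {m..}"
  shows "cut (attach a Y) m = a"
proof -
  note D = is_polyhedronD[OF a]
  have "fst a \<inter> {..<m} = fst a" "Y \<inter> {..<m} = {}"
    using assms(2,3) by force+
  moreover have "(\<lambda>u. u \<inter> {..<m}) ` snd a = snd a"
  proof -
    have "u \<inter> {..<m} = u" if "u \<in> snd a" for u
      using D(1)[OF that] assms(2) by blast
    then show ?thesis
      by simp
  qed
  moreover have "(\<lambda>u. u \<inter> {..<m}) ` (\<lambda>y. {y}) ` Y \<subseteq> snd a"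
    using assms(3) D(5) by auto
  ultimately show ?thesis
    unfolding cut_def attach_def
    by (intro prod_eqI) (simp_all add: Int_Un_distrib2 image_Un Un_absorb2)
qed

text \<open>Below \<open>attach a M\<close> every simplex is one of \<open>a\<close> or a singleton
  from \<open>M\<close>, so keeping \<open>a\<close> as an approximation leaves only the choice of
  the isolated vertices.\<close>

lemma pbasic_attach:
  assumes a: "a \<in> finite_polyhedra" and less: "\<forall>i\<in>fst a. \<forall>j\<in>M. i < j"
  shows "pbasic a (attach a M) = attach a ` {Y. infinite Y \<and> Y \<subseteq> M}"
proof -
  have a': "is_polyhedron a" "finite (fst a)"
    using a unfolding finite_polyhedra_def by auto
  show ?thesis
  proof (intro equalityI subsetI)
    fix B
    assume "B \<in> pbasic a (attach a M)"
    then obtain m where B: "is_polyhedron B" "infinite (fst B)" "polyhedron_le B (attach a M)"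
      "cut B m = a"
      by (rule pbasicE)
    note BD = is_polyhedronD[OF B(1)]
    have fst_a: "fst a = fst B \<inter> {..<m}" and snd_a: "snd a = (\<lambda>u. u \<inter> {..<m}) ` snd B"
      using B(4) unfolding cut_def by auto
    define Y where "Y = fst B - fst a"
    have "fst B = fst a \<union> Y"
      unfolding Y_def using fst_a by blast
    moreover have "snd B = snd a \<union> (\<lambda>y. {y}) ` Y"
    proof
      show "snd B \<subseteq> snd a \<union> (\<lambda>y. {y}) ` Y"
      proof
        fix u
        assume u: "u \<in> snd B"
        then have "u \<in> snd a \<or> (\<exists>y\<in>M. u = {y})"
          using B(3) unfolding polyhedron_le_iff attach_def by auto
        then show "u \<in> snd a \<union> (\<lambda>y. {y}) ` Y"
          using BD(1)[OF u] less unfolding Y_def by blast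
      qed
      \<comment> \<open>Simplices of \<open>a\<close> are traces of simplices of \<open>B\<close>,
        hence in \<open>snd B\<close> by heredity.\<close>
      show "snd a \<union> (\<lambda>y. {y}) ` Y \<subseteq> snd B"
        using BD(3,6) unfolding snd_a Y_def by blast
    qed
    ultimately have "B = attach a Y"
      unfolding attach_def by (simp add: prod_eqI)
    moreover have "infinite Y"
      unfolding Y_def using B(2) a'(2) by simp
    moreover have "Y \<subseteq> M"
      using B(3) unfolding Y_def polyhedron_le_iff attach_def by auto
    ultimately show "B \<in> attach a ` {Y. infinite Y \<and> Y \<subseteq> M}"
      by blast
  next
    fix B
    assume "B \<in> attach a ` {Y. infinite Y \<and> Y \<subseteq> M}"
    then obtain Y where Y: "B = attach a Y" "infinite Y" "Y \<subseteq> M"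
      by blast
    \<comment> \<open>All vertices of \<open>a\<close> precede this one, so cutting here removes
      exactly \<open>Y\<close>.\<close>
    define m where "m = (LEAST y. y \<in> Y)"
    have m: "m \<in> Y" "Y \<subseteq> {m..}"
      using Y(2) unfolding m_def by (auto intro: LeastI_ex Least_le simp: ex_in_conv)
    then have "cut B m = a"
      unfolding Y(1) using less Y(3) by (intro cut_attach[OF a'(1)]) auto
    moreover have "B \<in> infinite_polyhedra"
      unfolding Y(1) using a Y(2) by (rule attach_in_infinite_polyhedra)
    moreover have "polyhedron_le B (attach a M)"
      using Y(1,3) unfolding polyhedron_le_iff attach_def by auto
    ultimately show "B \<in> pbasic a (attach a M)"
      unfolding in_pbasic_iff by blast
  qed
qed

section \<open>Open sets of polyhedra\<close>

lemma openin_ptopology_pbasic: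
  "a \<in> finite_polyhedra \<Longrightarrow> A \<in> infinite_polyhedra \<Longrightarrow> openin ptopology (pbasic a A)"
  unfolding Ramsey_topology_def by (intro topology_generated_by_Basis) blast

text \<open>Requiring agreement of all cuts up to \<open>m\<close> makes the condition stable under
  enlarging \<open>m\<close>, so finite intersections go through with a maximum and the induction on
  generation of open sets works without proving that the basic sets form a base.\<close>

lemma openin_ptopology_imp:
  assumes "openin ptopology U" "B \<in> U"
  shows "\<exists>m. \<forall>C\<in>infinite_polyhedra. polyhedron_le C B \<and> (\<forall>i\<le>m. cut C i = cut B i) \<longrightarrow> C \<in> U"
proof -
  have "generate_topology_on {pbasic a A | a A. a \<in> finite_polyhedra \<and> A \<in> infinite_polyhedra} U"
    using assms(1) unfolding Ramsey_topology_def openin_topology_generated_by_iff .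
  then show ?thesis
    using assms(2)
  proof (induction arbitrary: B)
    case Empty
    then show ?case by simp
  next
    case (Int V W)
    obtain m where m: "\<forall>C\<in>infinite_polyhedra. polyhedron_le C B \<and>
        (\<forall>i\<le>m. cut C i = cut B i) \<longrightarrow> C \<in> V"
      using Int by blast
    obtain n where n: "\<forall>C\<in>infinite_polyhedra. polyhedron_le C B \<and>
        (\<forall>i\<le>n. cut C i = cut B i) \<longrightarrow> C \<in> W"
      using Int by blast
    show ?case
      using m n by (intro exI[of _ "max m n"]) auto
  next
    case (UN K)
    from UN.prems obtain V where V: "V \<in> K" "B \<in> V"
      by (rule UnionE)
    then have "V \<subseteq> \<Union>K"
      by auto
    then show ?case
      using UN.IH[OF V] by (meson subsetD)
  next
    case (Basis V)
    then obtain a A where V: "V = pbasic a A"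
      by blast
    obtain m where "cut B m = a" "polyhedron_le B A"
      using Basis(2) unfolding V by (rule pbasicE)
    then show ?case
      unfolding V in_pbasic_iff using polyhedron_le_trans by (metis order_refl)
  qed
qed

section \<open>Transfer from the Ellentuck space\<close>

text \<open>The values of \<open>k\<close> are the available isolated vertices, listed increasingly
  and all beyond \<open>a\<close>.\<close>

locale ellentuck_copy =
  fixes a :: polyhedron and k :: "nat \<Rightarrow> nat"
  assumes a: "a \<in> finite_polyhedra"
    and k: "strict_mono k"
    and above: "\<And>i j. i \<in> fst a \<Longrightarrow> i < k j"
begin

definition embed :: "nat set \<Rightarrow> polyhedron" where
  "embed Y = attach a (k ` Y)"

lemma infinite_image_k: "infinite (k ` Y) \<longleftrightarrow> infinite Y"
  using k by (simp add: finite_image_iff inj_on_subset strict_mono_imp_inj_on)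

lemma embed_in_infinite_polyhedra: "infinite Y \<Longrightarrow> embed Y \<in> infinite_polyhedra"
  unfolding embed_def using a infinite_image_k by (simp add: attach_in_infinite_polyhedra)

lemma pbasic_embed:
  assumes "finite s" "\<forall>i\<in>s. \<forall>j\<in>A. i < j"
  shows "pbasic (embed s) (embed (s \<union> A)) = embed ` {s \<union> Y | Y. infinite Y \<and> Y \<subseteq> A}"
proof -
  have "pbasic (embed s) (attach (embed s) (k ` A)) =
      attach (embed s) ` {Y. infinite Y \<and> Y \<subseteq> k ` A}"
  proof (rule pbasic_attach)
    show "embed s \<in> finite_polyhedra"
      unfolding embed_def using a assms(1) by (simp add: attach_in_finite_polyhedra)
    show "\<forall>i\<in>fst (embed s). \<forall>j\<in>k ` A. i < j"
      using above assms(2) k unfolding embed_def attach_def by (auto simp: strict_mono_less)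
  qed
  also have "{Y. infinite Y \<and> Y \<subseteq> k ` A} = image k ` {Y. infinite Y \<and> Y \<subseteq> A}"
    using infinite_image_k by (auto simp: subset_image_iff)
  finally have "pbasic (embed s) (embed (s \<union> A)) =
      (\<lambda>Y. embed (s \<union> Y)) ` {Y. infinite Y \<and> Y \<subseteq> A}"
    unfolding embed_def attach_attach by (simp add: image_image image_Un attach_attach)
  then show ?thesis
    by auto
qed

lemma pbasic_embed_empty: "pbasic a (embed A) = embed ` ellentuck_nbhd {} A"
  using pbasic_embed[of "{}" A] by (simp add: embed_def attach_def ellentuck_nbhd_def)

lemma embed_in_pbasic: "infinite H \<Longrightarrow> embed H \<in> pbasic a (embed UNIV)"
  unfolding pbasic_embed_empty by (intro imageI ellentuck_nbhdI[of _ _ H]) auto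

text \<open>Continuity of \<open>embed\<close>: fixing \<open>Y\<close> below \<open>m\<close> fixes
  the cuts of \<open>embed Y\<close> up to \<open>m\<close>, because \<open>k\<close> never moves a
  number downwards.\<close>

lemma ellentuck_open_vimage:
  assumes "openin ptopology U"
  shows "ellentuck_open (embed -` U)"
  unfolding ellentuck_open_def
proof (intro ballI impI)
  fix Y
  assume Y: "Y \<in> embed -` U" "infinite Y"
  then obtain m where m: "\<And>C. C \<in> infinite_polyhedra \<Longrightarrow> polyhedron_le C (embed Y) \<Longrightarrow>
      (\<And>i. i \<le> m \<Longrightarrow> cut C i = cut (embed Y) i) \<Longrightarrow> C \<in> U"
    using openin_ptopology_imp[OF assms, of "embed Y"] by auto
  have a': "{} \<in> snd a"
    using a is_polyhedronD(5) unfolding finite_polyhedra_def by blast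
  define s where "s = Y \<inter> {..<m}"
  have cut: "cut (embed (s \<union> Z)) i = cut (embed s) i" if Z: "Z \<subseteq> {m..}" and i: "i \<le> m" for Z i
  proof -
    have "\<not> k z < i" if "z \<in> Z" for z
      using strict_mono_imp_increasing[OF k, of z] that Z i by force
    then have disj: "k ` Z \<inter> {..<i} = {}"
      by auto
    have absorb: "A \<union> (B \<union> C) = A \<union> B" if "C \<subseteq> A" for A B C :: "nat set set"
      using that by blast
    \<comment> \<open>The late singletons leave only the empty trace, which the empty simplex of
      \<open>a\<close> already yields.\<close>
    have "(\<lambda>u. u \<inter> {..<i}) ` (\<lambda>y. {y}) ` k ` Z \<subseteq> {{} \<inter> {..<i}}"
      using disj by auto
    also have "\<dots> \<subseteq> (\<lambda>u. u \<inter> {..<i}) ` snd a"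
      using a' by blast
    finally have "(\<lambda>u. u \<inter> {..<i}) ` (snd a \<union> (\<lambda>y. {y}) ` k ` (s \<union> Z)) =
        (\<lambda>u. u \<inter> {..<i}) ` (snd a \<union> (\<lambda>y. {y}) ` k ` s)"
      unfolding image_Un by (rule absorb)
    moreover have "(fst a \<union> k ` (s \<union> Z)) \<inter> {..<i} = (fst a \<union> k ` s) \<inter> {..<i}"
      using disj by blast
    ultimately show ?thesis
      unfolding cut_def embed_def attach_def by simp
  qed
  have "embed Z \<in> U" if Z: "Z \<in> ellentuck_nbhd s Y" for Z
  proof -
    obtain V where V: "Z = s \<union> V" "infinite V" "V \<subseteq> Y" "\<forall>i\<in>s. \<forall>j\<in>V. i < j"
      using Z by (rule ellentuck_nbhdE)
    have "V \<subseteq> {m..}"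
      using V(3,4) unfolding s_def by force
    moreover have "Y = s \<union> (Y \<inter> {m..})"
      unfolding s_def by auto
    ultimately have "cut (embed Z) i = cut (embed Y) i" if "i \<le> m" for i
      using cut[of V i] cut[of "Y \<inter> {m..}" i] that V(1) by auto
    moreover have "polyhedron_le (embed Z) (embed Y)"
      using V(1,3) unfolding polyhedron_le_iff embed_def attach_def s_def by auto
    moreover have "embed Z \<in> infinite_polyhedra"
      using V(1,2) by (simp add: embed_in_infinite_polyhedra)
    ultimately show ?thesis
      using m by blast
  qed
  moreover have "Y \<in> ellentuck_nbhd s Y"
  proof (rule ellentuck_nbhdI)
    show "Y = s \<union> (Y - s)"
      unfolding s_def by auto
    show "infinite (Y - s)"
      using Y(2) unfolding s_def by simp
  qed (auto simp: s_def)
  ultimately show "\<exists>s. finite s \<and> Y \<in> ellentuck_nbhd s Y \<and> ellentuck_nbhd s Y \<subseteq> embed -` U"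
    by (intro exI[of _ s]) (auto simp: s_def)
qed

text \<open>The complement of the closure of \<open>N\<close> has an open preimage. It is also
  dense: every Ellentuck neighbourhood contains one that \<open>embed\<close> maps onto a nonempty
  open set of polyhedra, and this cannot lie inside the closure.\<close>

lemma completely_Ramsey_null_nowhere_dense:
  assumes "nowhere_dense_in ptopology N"
  shows "completely_Ramsey_null (embed -` N)"
proof (rule completely_Ramsey_null_disjoint_dense_open)
  let ?U = "topspace ptopology - ptopology closure_of N"
  have N: "N \<subseteq> topspace ptopology" "ptopology interior_of (ptopology closure_of N) = {}"
    using assms unfolding nowhere_dense_in_def by auto
  show "ellentuck_open (embed -` ?U)"
    by (intro ellentuck_open_vimage) (simp add: openin_diff)
  show "embed -` N \<inter> embed -` ?U = {}"
    using closure_of_subset[OF N(1)] by auto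
  fix s A :: "nat set"
  assume s: "finite s" and A: "infinite A"
  \<comment> \<open>Passing to the part beyond \<open>s\<close> meets the order hypothesis of
    \<open>pbasic_embed\<close>.\<close>
  define A' where "A' = {x \<in> A. \<forall>i\<in>s. i < x}"
  have A': "infinite A'" "\<forall>i\<in>s. \<forall>j\<in>A'. i < j"
    using infinite_above[OF s A] unfolding A'_def by auto
  let ?V = "pbasic (embed s) (embed (s \<union> A'))"
  have V_open: "openin ptopology ?V"
    using a s A'(1)
    by (intro openin_ptopology_pbasic embed_in_infinite_polyhedra)
      (auto simp: embed_def attach_in_finite_polyhedra)
  have V_eq: "?V = embed ` {s \<union> Y | Y. infinite Y \<and> Y \<subseteq> A'}"
    using pbasic_embed[OF s A'(2)] .
  have "?V \<noteq> {}"
    unfolding V_eq using A'(1) by blast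
  then have "\<not> ?V \<subseteq> ptopology closure_of N"
    using N(2) interior_of_maximal[OF _ V_open] by blast
  then obtain P where P: "P \<in> ?V" "P \<in> ?U"
    using openin_subset[OF V_open] by blast
  obtain Y where Y: "P = embed (s \<union> Y)" "infinite Y" "Y \<subseteq> A'"
    using P(1) unfolding V_eq by (elim imageE CollectE exE conjE) simp
  have "embed (s \<union> Y) \<in> ?U"
    using P(2) Y(1) by simp
  moreover have "s \<union> Y \<in> ellentuck_nbhd s A"
  proof (rule ellentuck_nbhdI[OF refl Y(2)])
    show "Y \<subseteq> A" "\<forall>i\<in>s. \<forall>j\<in>Y. i < j"
      using Y(3) unfolding A'_def by blast+
  qed
  ultimately show "ellentuck_nbhd s A \<inter> embed -` ?U \<noteq> {}"
    by (metis IntI empty_iff vimageI2)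
qed

lemma completely_Ramsey_null_meager:
  assumes "meager_in ptopology X"
  shows "completely_Ramsey_null (embed -` X)"
proof -
  obtain F where F: "countable F" "\<And>N. N \<in> F \<Longrightarrow> nowhere_dense_in ptopology N" "X = \<Union>F"
    using assms unfolding meager_in_def by blast
  have "completely_Ramsey_null (\<Union>((-`) embed ` F))"
    using F(1,2) completely_Ramsey_null_nowhere_dense
    by (intro completely_Ramsey_null_Union) auto
  then show ?thesis
    unfolding F(3) by (simp add: vimage_Union)
qed

lemma completely_Ramsey_Baire:
  assumes "Baire_property_in ptopology X"
  shows "completely_Ramsey (embed -` X)"
proof -
  obtain U where "openin ptopology U" and U: "meager_in ptopology (sym_diff X U)"
    using assms unfolding Baire_property_in_def by blast
  moreover have "embed -` sym_diff X U = sym_diff (embed -` X) (embed -` U)"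
    by auto
  ultimately show ?thesis
    using completely_Ramsey_null_meager[OF U] ellentuck_open_vimage
    by (intro ellentuck_Baire_imp_completely_Ramsey[of "embed -` U"]) auto
qed

end

section \<open>Copies below a given polyhedron and the conclusion\<close>

lemma obtain_ellentuck_copy:
  assumes "a \<in> finite_polyhedra" "pbasic a A \<noteq> {}"
  obtains k where "ellentuck_copy a k" "polyhedron_le (ellentuck_copy.embed a k UNIV) A"
proof -
  obtain C m where C: "is_polyhedron C" "infinite (fst C)" "polyhedron_le C A" "cut C m = a"
    using assms(2) by (meson ex_in_conv pbasicE)
  \<comment> \<open>The vertices of \<open>C\<close> outside its approximation \<open>a\<close>
    become the isolated ones.\<close>
  define N where "N = fst C \<inter> {m..}"
  have fst_a: "fst a = fst C \<inter> {..<m}" and snd_a: "snd a = (\<lambda>u. u \<inter> {..<m}) ` snd C"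
    using C(4) unfolding cut_def by auto
  have "fst C = fst a \<union> N"
    unfolding fst_a N_def by auto
  then have N: "infinite N"
    using C(2) assms(1) unfolding finite_polyhedra_def by (metis (lifting) finite_UnI mem_Collect_eq)
  interpret ellentuck_copy a "enumerate N"
  proof
    show "strict_mono (enumerate N)"
      using N by (rule strict_mono_enumerate)
    show "i < enumerate N j" if "i \<in> fst a" for i j
      using enumerate_in_set[OF N, of j] that unfolding fst_a N_def by auto
  qed (fact assms(1))
  have "embed UNIV = attach a N"
    unfolding embed_def range_enumerate[OF N] ..
  moreover have "polyhedron_le (attach a N) C"
    \<comment> \<open>Traces and singletons are simplices of \<open>C\<close>; its other simplices
      are dropped.\<close>
    using is_polyhedronD(3,6)[OF C(1)]
    unfolding polyhedron_le_iff attach_def fst_a snd_a N_def by auto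
  ultimately have "polyhedron_le (embed UNIV) C"
    by simp
  then show thesis
    using that ellentuck_copy_axioms polyhedron_le_trans C(3) by blast
qed

theorem theorem3p2p1:
  shows "topological_Ramsey_space infinite_polyhedra finite_polyhedra polyhedron_le approximation"
  unfolding topological_Ramsey_space_def Ramsey_set_def Ramsey_null_set_def
proof (intro conjI allI impI ballI)
  fix X a A
  assume X: "Baire_property_in ptopology X" and a: "a \<in> finite_polyhedra" "pbasic a A \<noteq> {}"
  obtain k where copy: "ellentuck_copy a k" and le: "polyhedron_le (ellentuck_copy.embed a k UNIV) A"
    using a by (rule obtain_ellentuck_copy)
  interpret ellentuck_copy a k
    by (fact copy)
  \<comment> \<open>The empty stem suffices, as it corresponds to \<open>a\<close> under
    \<open>embed\<close>.\<close>
  obtain H where "infinite H"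
    "ellentuck_nbhd {} H \<subseteq> embed -` X \<or> ellentuck_nbhd {} H \<inter> embed -` X = {}"
    using completely_Ramsey_Baire[OF X] infinite_UNIV_nat unfolding completely_Ramsey_def
    by (meson finite.emptyI)
  then have "pbasic a (embed H) \<subseteq> X \<or> pbasic a (embed H) \<inter> X = {}"
    unfolding pbasic_embed_empty by blast
  moreover have "embed H \<in> pbasic a A"
    using embed_in_pbasic[OF \<open>infinite H\<close>] pbasic_mono[OF le] by (rule rev_subsetD)
  ultimately show "\<exists>B\<in>pbasic a A. pbasic a B \<subseteq> X \<or> pbasic a B \<inter> X = {}"
    by (rule bexI)
next
  fix X a A
  assume X: "meager_in ptopology X" and a: "a \<in> finite_polyhedra" "pbasic a A \<noteq> {}"
  obtain k where copy: "ellentuck_copy a k" and le: "polyhedron_le (ellentuck_copy.embed a k UNIV) A"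
    using a by (rule obtain_ellentuck_copy)
  interpret ellentuck_copy a k
    by (fact copy)
  \<comment> \<open>The same transfer with the empty stem, now with avoidance of \<open>X\<close>
    guaranteed.\<close>
  have "\<exists>H\<subseteq>UNIV. infinite H \<and> ellentuck_nbhd {} H \<inter> embed -` X = {}"
    using completely_Ramsey_null_meager[OF X] infinite_UNIV_nat finite.emptyI
    unfolding completely_Ramsey_null_def by (metis (lifting))
  then obtain H where "infinite H" "ellentuck_nbhd {} H \<inter> embed -` X = {}"
    by (elim exE conjE) (rule that)
  then have "pbasic a (embed H) \<inter> X = {}"
    unfolding pbasic_embed_empty by blast
  moreover have "embed H \<in> pbasic a A"
    using embed_in_pbasic[OF \<open>infinite H\<close>] pbasic_mono[OF le] by (rule rev_subsetD)
  ultimately show "\<exists>B\<in>pbasic a A. pbasic a B \<inter> X = {}"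
    by (rule bexI)
qed

end
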